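(* Assume that the linear program $$\min_{P\in\mathcal{P}} C\cdot P,\qquad \mathcal{P}=\{P\in\mathbb{R}^{n\times n}: P\mathbf{1}=r,\ P^{\top}\mathbf{1}=c,\ P\ge 0,\ D_k\cdot P\ge 0\ (1\le k\le K),\ D_{l+K}\cdot P=0\ (1\le l\le L)\}$$ has a unique solution $P^{\star}$, where $\sum_i r_i=\sum_j c_j=1$, and assume that $\lVert D_k\rVert_\infty\le 1$ for $k=1,\dots,K$. For $\eta>0$ let $P^{\star}_\eta$ denote the $P$-component of the unique solution of the entropy-regularized problem $$\min_{P,s}\; C\cdot P+\frac1\eta\Big(\sum_{ij}p_{ij}\log p_{ij}+\sum_{k=1}^K s_k\log s_k\Big)$$ over $P\in\mathbb{R}^{n\times n}$, $P\geq 0$, and $s=(s_1,\dots,s_K)$, $s_k\ge 0$, subject to $P\mathbf{1}=r$, $P^{\top}\mathbf{1}=c$, $D_k\cdot P=s_k$ for $k=1,\dots,K$ and $D_{l+K}\cdot P=0$ for $l=1,\dots,L$. Then there exists a constant $\Delta>0$, depending only on the linear program (in particular not on $\eta$), namely the vertex optimality gap defined in the context, such that for every $\eta\ge \frac{(K+1)\left(1+\ln(4n^2(K+1))\right)}{\Delta}$, $$\lVert P^{\star}_\eta-P^{\star}\rVert_1\le 8\,n^{\frac{2}{K+1}}(K+1)\exp\left(-\eta\frac{\Delta}{K+1}\right).$$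
   Context: $C, D_1,\dots,D_{K+L}\in\mathbb{R}^{n\times n}$ are given matrices ($K$ inequality constraints, $L$ equality constraints), and $r,c\in\mathbb{R}^n$ are the (nonnegative) source and target densities. $M\cdot M'=\sum_{ij}m_{ij}m'_{ij}$ is the entrywise inner product; $\lVert M\rVert_1=\sum_{ij}|m_{ij}|$ and $\lVert M\rVert_\infty=\max_{ij}|m_{ij}|$ are entrywise norms; $\mathbf{1}$ is the all-ones vector; $0\log 0=0$; $P\ge 0$ is entrywise. Vertex optimality gap: let $\mathcal{V}$ be the set of vertices of the polyhedron $\mathcal{P}$ and $\mathcal{O}=\operatorname{argmin}_{P\in\mathcal{V}}C\cdot P$ the set of optimal vertices. Then $\Delta=\min_{Q\in\mathcal{V}\setminus\mathcal{O}}Q\cdot C-\min_{P\in\mathcal{O}}P\cdot C$. (If $\mathcal{V}=\mathcal{O}$, so that $\mathcal{P}$ is a single point, $\Delta$ may be taken to be any positive constant.) *)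

theory Defs
  imports "HOL-Analysis.Analysis"
begin

text \<open>
  Matrices are elements of \<^typ>\<open>real^'n^'n\<close>.  The library inner product on this type is the entrywise
  inner product and \<^const>\<open>infnorm\<close> is the entrywise maximum norm (the library's \<^const>\<open>norm\<close> is the
  Frobenius norm); the two facts below record this.
\<close>

lemma inner_matrix_entries:
  fixes M N :: "real^'n^'n"
  shows "M \<bullet> N = (\<Sum>i\<in>UNIV. \<Sum>j\<in>UNIV. M $ i $ j * N $ i $ j)"
  by (simp add: inner_vec_def)

lemma infnorm_matrix_entries:
  fixes M :: "real^'n^'n"
  shows "infnorm M = Max {\<bar>M $ i $ j\<bar> | i j. True}"
proof -
  have "(\<lambda>b. \<bar>M \<bullet> b\<bar>) ` Basis = {\<bar>M $ i $ j\<bar> | i j. True}"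
    by (auto simp: Basis_vec_def inner_axis image_iff) blast+
  then show ?thesis
    by (simp add: infnorm_Max)
qed

definition entry_norm1 :: "real^'n^'n \<Rightarrow> real" where
  "entry_norm1 M = (\<Sum>i\<in>UNIV. \<Sum>j\<in>UNIV. \<bar>M $ i $ j\<bar>)"

definition argmins :: "('a \<Rightarrow> real) \<Rightarrow> 'a set \<Rightarrow> 'a set" where
  "argmins f S = {x. is_arg_min f (\<lambda>y. y \<in> S) x}"

text \<open>
  The constraint matrices are \<open>D 1, \<dots>, D (K + L)\<close>: the first \<open>K\<close> give inequalities, the remaining
  \<open>L\<close> give equalities.  The cases \<open>K = 0\<close> and \<open>L = 0\<close> are allowed.
\<close>

definition constrained_couplings ::
    "real^'n \<Rightarrow> real^'n \<Rightarrow> (nat \<Rightarrow> real^'n^'n) \<Rightarrow> nat \<Rightarrow> nat \<Rightarrow> (real^'n^'n) set" where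
  "constrained_couplings r c D K L =
    {P. P *v 1 = r \<and> transpose P *v 1 = c \<and> (\<forall>i j. 0 \<le> P $ i $ j) \<and>
        (\<forall>k\<in>{1..K}. 0 \<le> D k \<bullet> P) \<and> (\<forall>l\<in>{1..L}. D (l + K) \<bullet> P = 0)}"

text \<open>
  The slack vector in \<open>\<real>\<^sup>K\<close> is an extensional function on \<open>{1..K}\<close>, so that it is determined by its
  \<open>K\<close> components and uniqueness of the minimizing pair is meaningful.
\<close>

definition slack_couplings ::
    "real^'n \<Rightarrow> real^'n \<Rightarrow> (nat \<Rightarrow> real^'n^'n) \<Rightarrow> nat \<Rightarrow> nat \<Rightarrow> ((real^'n^'n) \<times> (nat \<Rightarrow> real)) set" where
  "slack_couplings r c D K L =
    {(P, s). (\<forall>i j. 0 \<le> P $ i $ j) \<and> s \<in> {1..K} \<rightarrow>\<^sub>E {0..} \<and>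
        P *v 1 = r \<and> transpose P *v 1 = c \<and>
        (\<forall>k\<in>{1..K}. D k \<bullet> P = s k) \<and> (\<forall>l\<in>{1..L}. D (l + K) \<bullet> P = 0)}"

text \<open>The convention \<open>0 log 0 = 0\<close> holds because \<open>0 * x = 0\<close>, whatever the value of \<open>ln 0\<close>.\<close>

definition entropic_objective ::
    "real^'n^'n \<Rightarrow> nat \<Rightarrow> real \<Rightarrow> (real^'n^'n) \<times> (nat \<Rightarrow> real) \<Rightarrow> real" where
  "entropic_objective C K \<eta> = (\<lambda>(P, s).
    C \<bullet> P + 1 / \<eta> * ((\<Sum>i\<in>UNIV. \<Sum>j\<in>UNIV. P $ i $ j * ln (P $ i $ j)) + (\<Sum>k=1..K. s k * ln (s k))))"

definition entropic_solutions ::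
    "real^'n^'n \<Rightarrow> real^'n \<Rightarrow> real^'n \<Rightarrow> (nat \<Rightarrow> real^'n^'n) \<Rightarrow> nat \<Rightarrow> nat \<Rightarrow> real
      \<Rightarrow> ((real^'n^'n) \<times> (nat \<Rightarrow> real)) set" where
  "entropic_solutions C r c D K L \<eta> = argmins (entropic_objective C K \<eta>) (slack_couplings r c D K L)"

definition entropic_plan ::
    "real^'n^'n \<Rightarrow> real^'n \<Rightarrow> real^'n \<Rightarrow> (nat \<Rightarrow> real^'n^'n) \<Rightarrow> nat \<Rightarrow> nat \<Rightarrow> real \<Rightarrow> real^'n^'n" where
  "entropic_plan C r c D K L \<eta> = fst (THE x. x \<in> entropic_solutions C r c D K L \<eta>)"

text \<open>
  The gap is a relation, because every positive number counts as a gap when all vertices are optimal.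
\<close>

definition vertex_optimality_gap :: "real^'n^'n \<Rightarrow> (real^'n^'n) set \<Rightarrow> real \<Rightarrow> bool" where
  "vertex_optimality_gap C S \<Delta> \<longleftrightarrow>
    (let V = {v. v extreme_point_of S}; Opt = argmins (\<lambda>P. C \<bullet> P) V in
      if V = Opt then 0 < \<Delta>
      else \<Delta> = Min ((\<lambda>Q. Q \<bullet> C) ` (V - Opt)) - Min ((\<lambda>P. P \<bullet> C) ` Opt))"

end

theory Submission
  imports Defs "HOL-Real_Asymp.Real_Asymp"
begin

text \<open>
  Every feasible plan \<open>P\<close> determines its slacks \<open>s k = D k \<bullet> P\<close>, so the regularized problem is the
  minimization over \<open>constrained_couplings\<close> of \<open>C \<bullet> P + E P / \<eta>\<close>, where the negative entropy \<open>E\<close>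
  also counts the slacks.  The feasible set is a compact polyhedron and \<open>E\<close> is continuous and
  strictly convex, so there is exactly one minimizer \<open>Q\<close>.

  The rate comes from comparing \<open>Q\<close> with the linear optimum \<open>P\<^sup>* = Pstar\<close>.  By Minkowski's theorem
  \<open>Q = (1 - l) P\<^sup>* + l Y\<close> with \<open>Y\<close> a convex combination of suboptimal vertices, and hence
  \<open>l \<Delta> \<le> C \<bullet> Q - C \<bullet> P\<^sup>*\<close> (\<open>gap_decomposition\<close>).  Since \<open>Q\<close> and \<open>P\<^sup>*\<close> differ by
  \<open>l (Y - P\<^sup>*)\<close>, a difference of probability matrices scaled by \<open>l\<close>, it remains to bound \<open>l\<close>.
  Optimality of \<open>Q\<close> gives \<open>\<eta> l \<Delta> \<le> E P\<^sup>* - E Q\<close>: the linear cost of moving the mass \<open>l\<close> away from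
  \<open>P\<^sup>*\<close> must be paid for by entropy.  Mixing with weight \<open>l\<close> gains little entropy: because
  \<open>t ln t\<close> is superadditive and satisfies a product rule (\<open>xlnx_mult\<close>), the gain is at most \<open>l\<close> times
  the entropy of \<open>Y\<close>, plus \<open>l - l ln l\<close> for each unit of total mass (\<open>sum_xlnx_mixture\<close>).  The
  total mass of plan and slacks is at most \<open>K + 1\<close>, and the entropy of \<open>Y\<close> is at most
  \<open>2 ln n + K / e\<close>.  Division by \<open>l\<close> leaves
  \<open>\<eta> \<Delta> \<le> 2 ln n + K / e + (K + 1) (1 - ln l)\<close>, which is an exponentially small upper bound on \<open>l\<close>
  (\<open>mixture_weight_bound\<close>).
\<close>

section \<open>The function \<open>t ln t\<close>\<close>

definition xlnx :: "real \<Rightarrow> real" where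
  "xlnx t = t * ln t"

lemma xlnx_0 [simp]: "xlnx 0 = 0"
  by (simp add: xlnx_def)

text \<open>
  The right-hand side is the tangent of \<open>t ln t\<close> at \<open>m\<close>.  This one inequality yields strict
  convexity, the minimum value and the bound on the entropy of a probability vector below.
\<close>

lemma xlnx_tangent_less:
  assumes "0 \<le> t" "0 < m" "t \<noteq> m"
  shows "t * ln m + t - m < xlnx t"
proof (cases "t = 0")
  case False
  then have "ln m - ln t < (m - t) / t"
    using assms by (intro ln_diff_less) auto
  then have "t * (ln m - ln t) < m - t"
    using False assms(1) by (simp add: pos_less_divide_eq mult.commute)
  then show ?thesis
    by (simp add: xlnx_def algebra_simps)
qed (use assms in simp)

lemma xlnx_tangent:
  assumes "0 \<le> t" "0 < m"
  shows "t * ln m + t - m \<le> xlnx t"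
  using xlnx_tangent_less[OF assms] by (cases "t = m") (auto simp: xlnx_def)

lemma xlnx_strict_midpoint_convex:
  assumes "0 \<le> a" "0 \<le> b" "a \<noteq> b"
  shows "xlnx ((a + b) / 2) < (xlnx a + xlnx b) / 2"
proof -
  define m where "m = (a + b) / 2"
  have m: "0 < m" "a \<noteq> m" "b \<noteq> m"
    using assms by (auto simp: m_def)
  have "(a + b) * ln m + (a + b) - 2 * m < xlnx a + xlnx b"
    using xlnx_tangent_less[OF assms(1) m(1,2)] xlnx_tangent_less[OF assms(2) m(1,3)]
    by (simp add: algebra_simps)
  moreover have "a + b = 2 * m"
    by (simp add: m_def)
  ultimately have "xlnx m < (xlnx a + xlnx b) / 2"
    by (simp add: xlnx_def)
  then show ?thesis
    by (simp add: m_def)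
qed

lemma xlnx_midpoint_convex:
  assumes "0 \<le> a" "0 \<le> b"
  shows "xlnx ((a + b) / 2) \<le> (xlnx a + xlnx b) / 2"
  using xlnx_strict_midpoint_convex[OF assms] by (cases "a = b") auto

lemma xlnx_ge_minus_inverse_e:
  assumes "0 \<le> t"
  shows "- exp (- 1) \<le> xlnx t"
  using xlnx_tangent[OF assms, of "exp (- 1)"] by simp

lemma xlnx_nonpos:
  assumes "0 \<le> t" "t \<le> 1"
  shows "xlnx t \<le> 0"
proof (cases "t = 0")
  case False
  then have "ln t \<le> 0"
    using assms by simp
  then show ?thesis
    using assms by (simp add: xlnx_def mult_nonneg_nonpos)
qed simp

lemma xlnx_mult:
  assumes "0 \<le> a" "0 \<le> b"
  shows "xlnx (a * b) = a * xlnx b + b * xlnx a"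
  using assms by (cases "a = 0 \<or> b = 0") (auto simp: xlnx_def ln_mult algebra_simps)

lemma xlnx_superadditive:
  assumes "0 \<le> a" "0 \<le> b"
  shows "xlnx a + xlnx b \<le> xlnx (a + b)"
proof -
  have "xlnx x \<le> x * ln (x + y)" if "0 \<le> x" "0 \<le> y" for x y
  proof (cases "x = 0")
    case False
    then show ?thesis
      using that by (auto simp: xlnx_def intro!: mult_left_mono)
  qed simp
  from this[OF assms] this[OF assms(2,1)] show ?thesis
    by (simp add: xlnx_def algebra_simps)
qed

lemma continuous_on_xlnx: "continuous_on {0..} xlnx"
proof -
  have "(xlnx \<longlongrightarrow> xlnx x) (at x within {0..})" if "0 \<le> x" for x
  proof (cases "x = 0")
    case True
    have "{0..} - {0} = {0<..} - {0::real}"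
      by auto
    then have "at 0 within {0..} = at_right (0::real)"
      by (simp add: at_within_def)
    moreover have "((\<lambda>t::real. t * ln t) \<longlongrightarrow> 0) (at_right 0)"
      by real_asymp
    ultimately show ?thesis
      using True by (simp add: xlnx_def [abs_def])
  next
    case False
    then show ?thesis
      unfolding xlnx_def using that by (intro tendsto_intros) auto
  qed
  then show ?thesis
    by (simp add: continuous_on_def)
qed

text \<open>
  Superadditivity separates the two vectors in each summand, and the product rule separates the
  weights.  The last two summands on the left are the negative entropy of the choice between the
  vectors, weighted with their total masses; nothing is lost when the supports are disjoint.
\<close>

lemma sum_xlnx_mixture:
  assumes "\<And>i. i \<in> I \<Longrightarrow> 0 \<le> a i" "\<And>i. i \<in> I \<Longrightarrow> 0 \<le> b i" "0 \<le> l" "l \<le> 1"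
  shows "(1 - l) * (\<Sum>i\<in>I. xlnx (a i)) + l * (\<Sum>i\<in>I. xlnx (b i))
      + (\<Sum>i\<in>I. a i) * xlnx (1 - l) + (\<Sum>i\<in>I. b i) * xlnx l
    \<le> (\<Sum>i\<in>I. xlnx ((1 - l) * a i + l * b i))"
proof -
  have "(1 - l) * xlnx (a i) + l * xlnx (b i) + a i * xlnx (1 - l) + b i * xlnx l
      \<le> xlnx ((1 - l) * a i + l * b i)" if "i \<in> I" for i
    using xlnx_superadditive[of "(1 - l) * a i" "l * b i"] assms(1,2)[OF that] assms(3,4)
    by (simp add: xlnx_mult)
  then have "(\<Sum>i\<in>I. (1 - l) * xlnx (a i) + l * xlnx (b i) + a i * xlnx (1 - l) + b i * xlnx l)
      \<le> (\<Sum>i\<in>I. xlnx ((1 - l) * a i + l * b i))"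
    by (rule sum_mono)
  then show ?thesis
    by (simp add: sum.distrib sum_distrib_left sum_distrib_right)
qed

text \<open>The tangent is taken at the value \<open>1 / card I\<close> of the uniform distribution, which maximizes
  the entropy.\<close>

lemma sum_xlnx_ge_minus_ln_card:
  assumes "finite I" "\<And>i. i \<in> I \<Longrightarrow> 0 \<le> p i" "(\<Sum>i\<in>I. p i) = 1"
  shows "- ln (real (card I)) \<le> (\<Sum>i\<in>I. xlnx (p i))"
proof -
  define N where "N = real (card I)"
  have "I \<noteq> {}"
    using assms(3) by auto
  then have N: "0 < N"
    using assms(1) by (simp add: N_def card_gt_0_iff)
  have "- ln N = (\<Sum>i\<in>I. p i) * ln (1 / N) + (\<Sum>i\<in>I. p i) - N * (1 / N)"
    using N assms(3) by (simp add: ln_div)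
  also have "\<dots> = (\<Sum>i\<in>I. p i * ln (1 / N) + p i - 1 / N)"
    by (simp add: sum.distrib sum_subtractf sum_distrib_right N_def)
  also have "\<dots> \<le> (\<Sum>i\<in>I. xlnx (p i))"
    using N assms(2) by (intro sum_mono xlnx_tangent) auto
  finally show ?thesis
    by (simp add: N_def)
qed

section \<open>Minimizers and vertices\<close>

lemma argmins_iff: "x \<in> argmins f S \<longleftrightarrow> x \<in> S \<and> (\<forall>y\<in>S. f x \<le> f y)" for f :: "'a \<Rightarrow> real"
  by (auto simp: argmins_def is_arg_min_def not_less)

lemma argmins_image: "argmins f (g ` S) = g ` argmins (f \<circ> g) S" for f :: "'a \<Rightarrow> real"
  by (auto simp: argmins_iff intro!: imageI)

text \<open>
  A minimizer exists by compactness; two distinct ones would be beaten by their midpoint.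
\<close>

lemma unique_argmin_of_strictly_midpoint_convex:
  fixes f :: "'a::real_normed_vector \<Rightarrow> real"
  assumes "compact S" "convex S" "S \<noteq> {}" "continuous_on S f"
    and strict: "\<And>x y. x \<in> S \<Longrightarrow> y \<in> S \<Longrightarrow> x \<noteq> y \<Longrightarrow> f ((1/2) *\<^sub>R x + (1/2) *\<^sub>R y) < (f x + f y) / 2"
  shows "\<exists>x. argmins f S = {x}"
proof -
  obtain x where x: "x \<in> argmins f S"
    using continuous_attains_inf[OF assms(1,3,4)] by (auto simp: argmins_iff)
  have "y = x" if y: "y \<in> argmins f S" for y
  proof (rule ccontr)
    assume "y \<noteq> x"
    with x y have "f ((1/2) *\<^sub>R y + (1/2) *\<^sub>R x) < (f y + f x) / 2"
      by (intro strict) (auto simp: argmins_iff)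
    moreover have "(1/2) *\<^sub>R y + (1/2) *\<^sub>R x \<in> S"
      using x y \<open>convex S\<close> by (intro convexD) (auto simp: argmins_iff)
    ultimately show False
      using x y unfolding argmins_iff by (auto dest!: bspec)
  qed
  with x show ?thesis
    by blast
qed

lemma unique_linear_minimizer_extreme_point:
  assumes "argmins (\<lambda>x. c \<bullet> x) S = {x0}"
  shows "x0 extreme_point_of S"
proof -
  have min: "c \<bullet> x0 < c \<bullet> y" if "y \<in> S" "y \<noteq> x0" for y
    using that assms argmins_iff[of _ "\<lambda>x. c \<bullet> x" S]
    by (metis (full_types) antisym_conv2 order_trans singleton_iff)
  have "x0 \<notin> open_segment a b" if ab: "a \<in> S" "b \<in> S" for a b
  proof
    assume seg: "x0 \<in> open_segment a b"
    then obtain u where u: "0 < u" "u < 1" and x0: "x0 = (1 - u) *\<^sub>R a + u *\<^sub>R b"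
      by (auto simp: in_segment)
    have "a \<noteq> x0" "b \<noteq> x0"
      using seg by (auto simp: open_segment_def)
    then have "(1 - u) * (c \<bullet> x0) + u * (c \<bullet> x0) < (1 - u) * (c \<bullet> a) + u * (c \<bullet> b)"
      using u min ab by (intro add_strict_mono mult_strict_left_mono) auto
    also have "\<dots> = c \<bullet> x0"
      by (simp add: x0 inner_add_right)
    finally show False
      by (simp add: algebra_simps)
  qed
  moreover have "x0 \<in> S"
    using assms argmins_iff[of x0 "\<lambda>x. c \<bullet> x" S] by simp
  ultimately show ?thesis
    by (auto simp: extreme_point_of_def)
qed

text \<open>
  The minimum is also the minimum over the vertices, so that the only optimal vertex is \<open>P0\<close> and the
  gap is the distance of its value to that of the cheapest other vertex.
\<close>

lemma vertex_optimality_gap_unique: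
  fixes C P0 :: "real^'n^'n"
  assumes unique: "argmins (\<lambda>P. C \<bullet> P) S = {P0}"
  defines "V \<equiv> {v. v extreme_point_of S} - {P0}"
  shows "vertex_optimality_gap C S \<Delta> \<longleftrightarrow>
    (if V = {} then 0 < \<Delta> else \<Delta> = Min ((\<lambda>Q. C \<bullet> Q) ` V) - C \<bullet> P0)"
proof -
  have P0: "P0 extreme_point_of S"
    using unique by (rule unique_linear_minimizer_extreme_point)
  have "argmins (\<lambda>P. C \<bullet> P) {v. v extreme_point_of S} = {P0}"
  proof -
    have "\<And>y. y \<in> S \<Longrightarrow> C \<bullet> P0 \<le> C \<bullet> y" "\<And>y. y \<in> S \<Longrightarrow> C \<bullet> y \<le> C \<bullet> P0 \<Longrightarrow> y = P0"
      using unique argmins_iff[of _ "\<lambda>P. C \<bullet> P" S] by (metis order_trans singleton_iff)+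
    then show ?thesis
      using P0 by (auto simp: argmins_iff extreme_point_of_def)
  qed
  moreover have "{v. v extreme_point_of S} = {P0} \<longleftrightarrow> V = {}"
    using P0 by (auto simp: V_def)
  ultimately show ?thesis
    by (simp add: vertex_optimality_gap_def Let_def V_def inner_commute)
qed

lemma vertex_optimality_gap_exists_pos:
  fixes C P0 :: "real^'n^'n"
  assumes "polyhedron S" and unique: "argmins (\<lambda>P. C \<bullet> P) S = {P0}"
  shows "\<exists>\<Delta>. vertex_optimality_gap C S \<Delta>"
    and "vertex_optimality_gap C S \<Delta> \<Longrightarrow> 0 < \<Delta>"
proof -
  show "\<exists>\<Delta>. vertex_optimality_gap C S \<Delta>"
    unfolding vertex_optimality_gap_unique[OF unique]
    by (cases "{v. v extreme_point_of S} - {P0} = {}") (auto intro: exI[of _ 1])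
  assume gap: "vertex_optimality_gap C S \<Delta>"
  define V where "V = {v. v extreme_point_of S} - {P0}"
  show "0 < \<Delta>"
  proof (cases "V = {}")
    case True
    then show ?thesis
      using gap by (simp add: vertex_optimality_gap_unique[OF unique] V_def)
  next
    case False
    have "finite V"
      using finite_polyhedron_extreme_points[OF assms(1)] by (simp add: V_def)
    moreover have "C \<bullet> P0 < C \<bullet> Q" if "Q \<in> V" for Q
      using that unique argmins_iff[of _ "\<lambda>P. C \<bullet> P" S]
      by (metis (mono_tags, lifting) DiffE V_def extreme_point_of_def mem_Collect_eq
          not_le order_trans singleton_iff)
    ultimately have "C \<bullet> P0 < Min ((\<lambda>Q. C \<bullet> Q) ` V)"
      using False by simp
    then show ?thesis
      using gap False by (simp add: vertex_optimality_gap_unique[OF unique] V_def)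
  qed
qed

text \<open>
  Minkowski's theorem, with the weight of the optimal vertex separated from the others: all the
  remaining vertices, hence all their convex combinations, cost at least \<open>\<Delta>\<close> more.
\<close>

lemma gap_decomposition:
  fixes C P0 :: "real^'n^'n"
  assumes "compact S" "polyhedron S" and unique: "argmins (\<lambda>P. C \<bullet> P) S = {P0}"
    and gap: "vertex_optimality_gap C S \<Delta>" and "Q \<in> S"
  obtains l Y where "0 \<le> l" "l \<le> 1" "Y \<in> S" "Q = (1 - l) *\<^sub>R P0 + l *\<^sub>R Y"
    "l * \<Delta> \<le> C \<bullet> Q - C \<bullet> P0"
proof -
  define V where "V = {v. v extreme_point_of S} - {P0}"
  have convex: "convex S"
    using assms(2) by (rule polyhedron_imp_convex)
  have P0: "P0 extreme_point_of S"
    using unique by (rule unique_linear_minimizer_extreme_point)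
  then have "{v. v extreme_point_of S} = insert P0 V"
    by (auto simp: V_def)
  then have Q: "Q \<in> convex hull (insert P0 V)"
    using Krein_Milman_Minkowski[OF assms(1) convex] \<open>Q \<in> S\<close> by metis
  show thesis
  proof (cases "V = {}")
    \<comment> \<open>\<open>S\<close> is a single point and \<open>\<Delta>\<close> can be any positive number, so the weight has to be 0.\<close>
    case True
    then have "Q = P0"
      using Q by simp
    then show thesis
      using that[of 0 P0] \<open>Q \<in> S\<close> by simp
  next
    case False
    have "finite V"
      using finite_polyhedron_extreme_points[OF assms(2)] by (simp add: V_def)
    then have "V \<subseteq> {Y. C \<bullet> P0 + \<Delta> \<le> C \<bullet> Y}"
      using gap False by (auto simp: vertex_optimality_gap_unique[OF unique] V_def[symmetric])
    then have hull: "convex hull V \<subseteq> {Y. C \<bullet> P0 + \<Delta> \<le> C \<bullet> Y}"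
      using convex_halfspace_ge[of "C \<bullet> P0 + \<Delta>" C] by (intro hull_minimal) auto
    have "V \<subseteq> S"
      by (auto simp: V_def extreme_point_of_def)
    then have hull_S: "convex hull V \<subseteq> S"
      using convex by (intro hull_minimal)
    obtain u l Y where *: "0 \<le> u" "0 \<le> l" "u + l = 1" "Y \<in> convex hull V" "Q = u *\<^sub>R P0 + l *\<^sub>R Y"
      using Q unfolding convex_hull_insert[OF False] by auto
    then have u: "u = 1 - l"
      by simp
    have "l * (C \<bullet> P0 + \<Delta>) \<le> l * (C \<bullet> Y)"
      using * hull by (intro mult_left_mono) auto
    then have "l * \<Delta> \<le> C \<bullet> Q - C \<bullet> P0"
      by (simp add: *(5) u inner_add_right algebra_simps)
    then show thesis
      using * u hull_S by (intro that[of l Y]) auto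
  qed
qed

section \<open>The polyhedron of constrained couplings\<close>

lemma polyhedron_linear_eq:
  fixes f :: "'a::euclidean_space \<Rightarrow> real"
  assumes "linear f"
  shows "polyhedron {x. f x = b}"
proof -
  have "f x = adjoint f 1 \<bullet> x" for x
    using adjoint_works[OF assms, of x 1] by (simp add: inner_commute)
  then show ?thesis
    by (simp add: polyhedron_hyperplane)
qed

lemma polyhedron_linear_ge:
  fixes f :: "'a::euclidean_space \<Rightarrow> real"
  assumes "linear f"
  shows "polyhedron {x. b \<le> f x}"
proof -
  have "f x = adjoint f 1 \<bullet> x" for x
    using adjoint_works[OF assms, of x 1] by (simp add: inner_commute)
  then show ?thesis
    using polyhedron_halfspace_ge[where a = "adjoint f 1" and b = b] by simp
qed

lemma polyhedron_finite_ball: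
  assumes "finite I" "\<And>i. i \<in> I \<Longrightarrow> polyhedron {x. \<phi> i x}"
  shows "polyhedron {x. \<forall>i\<in>I. \<phi> i x}"
proof -
  have "{x. \<forall>i\<in>I. \<phi> i x} = \<Inter>((\<lambda>i. {x. \<phi> i x}) ` I)"
    by auto
  then show ?thesis
    using assms by (metis (mono_tags, lifting) finite_imageI imageE polyhedron_Inter)
qed

lemma polyhedron_conj:
  assumes "polyhedron {x. \<phi> x}" "polyhedron {x. \<psi> x}"
  shows "polyhedron {x. \<phi> x \<and> \<psi> x}"
  using polyhedron_Int[OF assms] by (simp add: Collect_conj_eq)

lemma polyhedron_constrained_couplings:
  fixes r c :: "real^'n"
  shows "polyhedron (constrained_couplings r c D K L)"
proof -
  have rows: "P *v 1 = r \<longleftrightarrow> (\<forall>i\<in>UNIV. (\<Sum>j\<in>UNIV. P $ i $ j) = r $ i)" for P :: "real^'n^'n"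
    by (simp add: vec_eq_iff matrix_vector_mult_def)
  have cols: "transpose P *v 1 = c \<longleftrightarrow> (\<forall>j\<in>UNIV. (\<Sum>i\<in>UNIV. P $ i $ j) = c $ j)" for P :: "real^'n^'n"
    by (simp add: vec_eq_iff matrix_vector_mult_def transpose_def)
  have nonneg: "(\<forall>i j. 0 \<le> P $ i $ j) \<longleftrightarrow> (\<forall>i\<in>UNIV. \<forall>j\<in>UNIV. 0 \<le> P $ i $ j)" for P :: "real^'n^'n"
    by simp
  show ?thesis
    unfolding constrained_couplings_def rows cols nonneg
    by (intro polyhedron_conj polyhedron_finite_ball polyhedron_linear_eq polyhedron_linear_ge
        linearI finite finite_atLeastAtMost)
      (simp_all add: sum.distrib sum_distrib_left inner_add_right)
qed

lemma constrained_couplings_nonneg: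
  "P \<in> constrained_couplings r c D K L \<Longrightarrow> 0 \<le> P $ i $ j"
  by (simp add: constrained_couplings_def)

lemma constrained_couplings_slack_nonneg:
  "P \<in> constrained_couplings r c D K L \<Longrightarrow> k \<in> {1..K} \<Longrightarrow> 0 \<le> D k \<bullet> P"
  by (simp add: constrained_couplings_def)

lemma constrained_couplings_total_mass:
  fixes r :: "real^'n"
  assumes "P \<in> constrained_couplings r c D K L" "(\<Sum>i\<in>UNIV. r $ i) = 1"
  shows "(\<Sum>i\<in>UNIV. \<Sum>j\<in>UNIV. P $ i $ j) = 1"
proof -
  have "(\<Sum>j\<in>UNIV. P $ i $ j) = r $ i" for i
    using assms(1) by (auto simp: constrained_couplings_def matrix_vector_mult_def)
  then show ?thesis
    using assms(2) by simp
qed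

lemma constrained_couplings_entry_norm1:
  fixes r :: "real^'n"
  assumes "P \<in> constrained_couplings r c D K L" "(\<Sum>i\<in>UNIV. r $ i) = 1"
  shows "entry_norm1 P = 1"
  using constrained_couplings_total_mass[OF assms] constrained_couplings_nonneg[OF assms(1)]
  by (simp add: entry_norm1_def)

lemma entry_norm1_triangle: "entry_norm1 (M - N) \<le> entry_norm1 M + entry_norm1 N"
  unfolding entry_norm1_def sum.distrib[symmetric] by (intro sum_mono) (simp add: abs_triangle_ineq4)

lemma entry_norm1_scaleR: "entry_norm1 (a *\<^sub>R M) = \<bar>a\<bar> * entry_norm1 M"
  by (simp add: entry_norm1_def abs_mult sum_distrib_left)

lemma norm_le_entry_norm1: "norm M \<le> entry_norm1 M"
proof -
  have "norm M \<le> (\<Sum>i\<in>UNIV. norm (M $ i))"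
    unfolding norm_vec_def by (rule L2_set_le_sum) simp
  also have "\<dots> \<le> entry_norm1 M"
    unfolding entry_norm1_def by (intro sum_mono norm_le_l1_cart)
  finally show ?thesis .
qed

lemma inner_le_infnorm_entry_norm1:
  fixes M N :: "real^'n^'n"
  shows "M \<bullet> N \<le> infnorm M * entry_norm1 N"
proof -
  have "M $ i $ j * N $ i $ j \<le> infnorm M * \<bar>N $ i $ j\<bar>" for i j
  proof -
    have "axis i (axis j 1) \<in> (Basis :: (real^'n^'n) set)"
      by (simp add: axis_in_Basis_iff)
    from Basis_le_infnorm[OF this, of M] have "\<bar>M $ i $ j\<bar> \<le> infnorm M"
      by (simp add: inner_axis)
    then have "\<bar>M $ i $ j * N $ i $ j\<bar> \<le> infnorm M * \<bar>N $ i $ j\<bar>"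
      by (simp add: abs_mult mult_right_mono)
    then show ?thesis
      by linarith
  qed
  then show ?thesis
    unfolding inner_matrix_entries entry_norm1_def sum_distrib_left by (intro sum_mono)
qed

lemma constrained_couplings_slack_le_1:
  fixes r :: "real^'n"
  assumes "P \<in> constrained_couplings r c D K L" "(\<Sum>i\<in>UNIV. r $ i) = 1" "infnorm (D k) \<le> 1"
  shows "D k \<bullet> P \<le> 1"
  using inner_le_infnorm_entry_norm1[of "D k" P] constrained_couplings_entry_norm1[OF assms(1,2)] assms(3)
  by simp

lemma compact_constrained_couplings:
  fixes r :: "real^'n"
  assumes "(\<Sum>i\<in>UNIV. r $ i) = 1"
  shows "compact (constrained_couplings r c D K L)"
proof -
  have "norm P \<le> 1" if "P \<in> constrained_couplings r c D K L" for P
    using norm_le_entry_norm1[of P] constrained_couplings_entry_norm1[OF that assms] by simp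
  then have "bounded (constrained_couplings r c D K L)"
    by (auto simp: bounded_iff)
  then show ?thesis
    using polyhedron_imp_closed[OF polyhedron_constrained_couplings] by (simp add: compact_eq_bounded_closed)
qed

section \<open>The regularized problem on couplings\<close>

definition coupling_negentropy :: "(nat \<Rightarrow> real^'n^'n) \<Rightarrow> nat \<Rightarrow> real^'n^'n \<Rightarrow> real" where
  "coupling_negentropy D K P =
    (\<Sum>i\<in>UNIV. \<Sum>j\<in>UNIV. xlnx (P $ i $ j)) + (\<Sum>k=1..K. xlnx (D k \<bullet> P))"

definition with_slacks ::
    "(nat \<Rightarrow> real^'n^'n) \<Rightarrow> nat \<Rightarrow> real^'n^'n \<Rightarrow> (real^'n^'n) \<times> (nat \<Rightarrow> real)" where
  "with_slacks D K P = (P, restrict (\<lambda>k. D k \<bullet> P) {1..K})"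

lemma slack_couplings_eq: "slack_couplings r c D K L = with_slacks D K ` constrained_couplings r c D K L"
proof (intro equalityI subsetI)
  fix x assume "x \<in> slack_couplings r c D K L"
  then obtain P s where x: "x = (P, s)" and Ps: "(P, s) \<in> slack_couplings r c D K L"
    by (cases x) auto
  have s: "s = restrict (\<lambda>k. D k \<bullet> P) {1..K}"
  proof
    fix k show "s k = restrict (\<lambda>k. D k \<bullet> P) {1..K} k"
      using Ps by (auto simp: slack_couplings_def PiE_def extensional_def)
  qed
  have "P \<in> constrained_couplings r c D K L"
    using Ps by (auto simp: slack_couplings_def constrained_couplings_def PiE_def Pi_def)
  then show "x \<in> with_slacks D K ` constrained_couplings r c D K L"
    unfolding x by (subst s) (simp add: with_slacks_def)
qed (auto simp: with_slacks_def slack_couplings_def constrained_couplings_def)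

lemma entropic_objective_with_slacks:
  "entropic_objective C K \<eta> (with_slacks D K P) = C \<bullet> P + 1 / \<eta> * coupling_negentropy D K P"
  by (simp add: entropic_objective_def with_slacks_def coupling_negentropy_def xlnx_def)

lemma entropic_solutions_eq:
  "entropic_solutions C r c D K L \<eta> = with_slacks D K `
    argmins (\<lambda>P. C \<bullet> P + 1 / \<eta> * coupling_negentropy D K P) (constrained_couplings r c D K L)"
  by (simp add: entropic_solutions_def slack_couplings_eq argmins_image comp_def
      entropic_objective_with_slacks)

lemma continuous_on_coupling_negentropy:
  "continuous_on (constrained_couplings r c D K L) (coupling_negentropy D K)"
proof -
  have *: "continuous_on (constrained_couplings r c D K L) (\<lambda>P. xlnx (f P))"
    if "continuous_on UNIV f" "\<And>P. P \<in> constrained_couplings r c D K L \<Longrightarrow> 0 \<le> f P"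
    for f :: "real^'n^'n \<Rightarrow> real" and r c :: "real^'n" and D
    using that by (intro continuous_on_compose2[OF continuous_on_xlnx])
      (auto intro: continuous_on_subset)
  show ?thesis
    unfolding coupling_negentropy_def
    by (intro continuous_on_add continuous_on_sum * continuous_intros
        constrained_couplings_nonneg constrained_couplings_slack_nonneg)
qed

text \<open>
  Two distinct matrices differ in an entry, and the summand of that entry is strictly convex; the
  slack terms contribute only convexity.
\<close>

lemma coupling_negentropy_strict_midpoint_convex:
  assumes P: "P \<in> constrained_couplings r c D K L" and Q: "Q \<in> constrained_couplings r c D K L"
    and "P \<noteq> Q"
  shows "coupling_negentropy D K ((1/2) *\<^sub>R P + (1/2) *\<^sub>R Q)
    < (coupling_negentropy D K P + coupling_negentropy D K Q) / 2"
proof -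
  let ?M = "(1/2) *\<^sub>R P + (1/2) *\<^sub>R Q"
  have M: "?M $ i $ j = (P $ i $ j + Q $ i $ j) / 2" for i j
    by simp
  have le: "xlnx (?M $ i $ j) \<le> (xlnx (P $ i $ j) + xlnx (Q $ i $ j)) / 2" for i j
    unfolding M by (intro xlnx_midpoint_convex constrained_couplings_nonneg[OF P]
        constrained_couplings_nonneg[OF Q])
  obtain a b where ab: "P $ a $ b \<noteq> Q $ a $ b"
    using \<open>P \<noteq> Q\<close> by (auto simp: vec_eq_iff)
  have less: "xlnx (?M $ a $ b) < (xlnx (P $ a $ b) + xlnx (Q $ a $ b)) / 2"
    unfolding M by (intro xlnx_strict_midpoint_convex ab constrained_couplings_nonneg[OF P]
        constrained_couplings_nonneg[OF Q])
  have "(\<Sum>i\<in>UNIV. \<Sum>j\<in>UNIV. xlnx (?M $ i $ j))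
      < (\<Sum>i\<in>UNIV. \<Sum>j\<in>UNIV. (xlnx (P $ i $ j) + xlnx (Q $ i $ j)) / 2)"
  proof (rule sum_strict_mono_ex1)
    show "\<exists>i\<in>UNIV. (\<Sum>j\<in>UNIV. xlnx (?M $ i $ j))
        < (\<Sum>j\<in>UNIV. (xlnx (P $ i $ j) + xlnx (Q $ i $ j)) / 2)"
      using le less by (intro bexI[of _ a] sum_strict_mono_ex1 bexI[of _ b]) auto
  qed (use le in \<open>auto intro!: sum_mono\<close>)
  moreover have "(\<Sum>k=1..K. xlnx (D k \<bullet> ?M)) \<le> (\<Sum>k=1..K. (xlnx (D k \<bullet> P) + xlnx (D k \<bullet> Q)) / 2)"
  proof (rule sum_mono)
    fix k assume k: "k \<in> {1..K}"
    have "D k \<bullet> ?M = (D k \<bullet> P + D k \<bullet> Q) / 2"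
      by (simp add: inner_add_right)
    then show "xlnx (D k \<bullet> ?M) \<le> (xlnx (D k \<bullet> P) + xlnx (D k \<bullet> Q)) / 2"
      using xlnx_midpoint_convex constrained_couplings_slack_nonneg[OF P k]
        constrained_couplings_slack_nonneg[OF Q k] by metis
  qed
  ultimately show ?thesis
    unfolding coupling_negentropy_def
    by (simp add: sum.distrib sum_divide_distrib[symmetric] add_divide_distrib)
qed

lemma entropic_solution_unique:
  fixes C :: "real^'n^'n" and r c :: "real^'n"
  assumes "(\<Sum>i\<in>UNIV. r $ i) = 1" "constrained_couplings r c D K L \<noteq> {}" "0 < \<eta>"
  obtains Q where "entropic_solutions C r c D K L \<eta> = {with_slacks D K Q}"
    "argmins (\<lambda>P. C \<bullet> P + 1 / \<eta> * coupling_negentropy D K P) (constrained_couplings r c D K L) = {Q}"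
proof -
  let ?S = "constrained_couplings r c D K L"
  let ?F = "\<lambda>P. C \<bullet> P + 1 / \<eta> * coupling_negentropy D K P"
  have "\<exists>Q. argmins ?F ?S = {Q}"
  proof (rule unique_argmin_of_strictly_midpoint_convex)
    show "compact ?S"
      by (rule compact_constrained_couplings[OF assms(1)])
    show "convex ?S"
      by (rule polyhedron_imp_convex[OF polyhedron_constrained_couplings])
    show "continuous_on ?S ?F"
      by (intro continuous_intros continuous_on_coupling_negentropy)
    show "?F ((1/2) *\<^sub>R P + (1/2) *\<^sub>R Q) < (?F P + ?F Q) / 2" if "P \<in> ?S" "Q \<in> ?S" "P \<noteq> Q" for P Q
    proof -
      have "1 / \<eta> * coupling_negentropy D K ((1/2) *\<^sub>R P + (1/2) *\<^sub>R Q)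
          < 1 / \<eta> * ((coupling_negentropy D K P + coupling_negentropy D K Q) / 2)"
        using coupling_negentropy_strict_midpoint_convex[OF that] assms(3)
        by (intro mult_strict_left_mono) auto
      then show ?thesis
        by (simp add: inner_add_right add_divide_distrib distrib_left)
    qed
  qed (rule assms(2))
  then obtain Q where Q: "argmins ?F ?S = {Q}"
    by blast
  then have "entropic_solutions C r c D K L \<eta> = {with_slacks D K Q}"
    by (simp add: entropic_solutions_eq)
  with Q show thesis
    using that by blast
qed

section \<open>Entropy bounds and the convergence rate\<close>

lemma coupling_negentropy_nonpos:
  fixes r :: "real^'n"
  assumes P: "P \<in> constrained_couplings r c D K L" and r: "(\<Sum>i\<in>UNIV. r $ i) = 1"
    and D: "\<forall>k\<in>{1..K}. infnorm (D k) \<le> 1"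
  shows "coupling_negentropy D K P \<le> 0"
proof -
  have "P $ i $ j \<le> 1" for i j
  proof -
    have "P $ i $ j \<le> (\<Sum>j\<in>UNIV. P $ i $ j)"
      using constrained_couplings_nonneg[OF P] by (intro member_le_sum) auto
    also have "\<dots> \<le> (\<Sum>i\<in>UNIV. \<Sum>j\<in>UNIV. P $ i $ j)"
      using constrained_couplings_nonneg[OF P]
      by (intro member_le_sum[of _ _ "\<lambda>i. \<Sum>j\<in>UNIV. P $ i $ j"] sum_nonneg) auto
    finally show ?thesis
      using constrained_couplings_total_mass[OF P r] by simp
  qed
  then show ?thesis
    unfolding coupling_negentropy_def
    using constrained_couplings_nonneg[OF P] constrained_couplings_slack_nonneg[OF P]
      constrained_couplings_slack_le_1[OF P r] D
    by (intro add_nonpos_nonpos sum_nonpos xlnx_nonpos) auto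
qed

lemma coupling_negentropy_ge:
  fixes r :: "real^'n"
  assumes P: "P \<in> constrained_couplings r c D K L" and r: "(\<Sum>i\<in>UNIV. r $ i) = 1"
  shows "- (2 * ln (real CARD('n)) + real K * exp (- 1)) \<le> coupling_negentropy D K P"
proof -
  have "(\<Sum>ij\<in>UNIV. P $ fst ij $ snd ij) = (1::real)"
    using constrained_couplings_total_mass[OF P r]
    by (simp add: sum.cartesian_product UNIV_Times_UNIV[symmetric] case_prod_beta del: UNIV_Times_UNIV)
  then have "- ln (real (card (UNIV :: ('n \<times> 'n) set))) \<le> (\<Sum>ij\<in>UNIV. xlnx (P $ fst ij $ snd ij))"
    using constrained_couplings_nonneg[OF P] by (intro sum_xlnx_ge_minus_ln_card) auto
  then have "- (2 * ln (real CARD('n))) \<le> (\<Sum>i\<in>UNIV. \<Sum>j\<in>UNIV. xlnx (P $ i $ j))"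
    by (simp add: sum.cartesian_product UNIV_Times_UNIV[symmetric] case_prod_beta card_cartesian_product
        ln_mult del: UNIV_Times_UNIV)
  moreover have "(\<Sum>k=1..K. - exp (- 1)) \<le> (\<Sum>k=1..K. xlnx (D k \<bullet> P))"
    using constrained_couplings_slack_nonneg[OF P] by (intro sum_mono xlnx_ge_minus_inverse_e)
  ultimately show ?thesis
    by (simp add: coupling_negentropy_def)
qed

text \<open>
  Both total masses lie between 0 and \<open>K + 1\<close>, so the mixing entropy is bounded by \<open>K + 1\<close> times
  \<open>- xlnx l - xlnx (1 - l)\<close>, whose second summand is at most \<open>l\<close>.
\<close>

lemma coupling_negentropy_mixture:
  fixes r :: "real^'n"
  assumes P: "P \<in> constrained_couplings r c D K L" and Y: "Y \<in> constrained_couplings r c D K L"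
    and r: "(\<Sum>i\<in>UNIV. r $ i) = 1" and D: "\<forall>k\<in>{1..K}. infnorm (D k) \<le> 1"
    and l: "0 \<le> l" "l \<le> 1"
  shows "(1 - l) * coupling_negentropy D K P + l * coupling_negentropy D K Y
      - (real K + 1) * (l - xlnx l)
    \<le> coupling_negentropy D K ((1 - l) *\<^sub>R P + l *\<^sub>R Y)"
proof -
  define SP SY where "SP = (\<Sum>k=1..K. D k \<bullet> P)" and "SY = (\<Sum>k=1..K. D k \<bullet> Y)"
  define EP EY where "EP = (\<Sum>i\<in>UNIV. \<Sum>j\<in>UNIV. xlnx (P $ i $ j))"
    and "EY = (\<Sum>i\<in>UNIV. \<Sum>j\<in>UNIV. xlnx (Y $ i $ j))"
  let ?M = "(1 - l) *\<^sub>R P + l *\<^sub>R Y"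
  have "(1 - l) * EP + l * EY + xlnx (1 - l) + xlnx l
      \<le> (\<Sum>i\<in>UNIV. \<Sum>j\<in>UNIV. xlnx (?M $ i $ j))"
    using sum_xlnx_mixture[of "UNIV :: ('n \<times> 'n) set" "\<lambda>ij. P $ fst ij $ snd ij" "\<lambda>ij. Y $ fst ij $ snd ij",
        OF constrained_couplings_nonneg[OF P] constrained_couplings_nonneg[OF Y] l]
      constrained_couplings_total_mass[OF P r] constrained_couplings_total_mass[OF Y r]
    by (simp add: sum.cartesian_product UNIV_Times_UNIV[symmetric] case_prod_beta EP_def EY_def
        del: UNIV_Times_UNIV)
  moreover have "(1 - l) * (\<Sum>k=1..K. xlnx (D k \<bullet> P)) + l * (\<Sum>k=1..K. xlnx (D k \<bullet> Y))
        + SP * xlnx (1 - l) + SY * xlnx l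
      \<le> (\<Sum>k=1..K. xlnx (D k \<bullet> ?M))"
    using sum_xlnx_mixture[of "{1..K}" "\<lambda>k. D k \<bullet> P" "\<lambda>k. D k \<bullet> Y",
        OF constrained_couplings_slack_nonneg[OF P] constrained_couplings_slack_nonneg[OF Y] l]
    by (simp add: SP_def SY_def inner_add_right)
  moreover have "real K * xlnx (1 - l) \<le> SP * xlnx (1 - l)" "real K * xlnx l \<le> SY * xlnx l"
  proof -
    have "SP \<le> (\<Sum>k=1..K. 1)" "SY \<le> (\<Sum>k=1..K. 1)"
      unfolding SP_def SY_def using D
      by (intro sum_mono constrained_couplings_slack_le_1[OF P r]
          constrained_couplings_slack_le_1[OF Y r]; blast)+
    then show "real K * xlnx (1 - l) \<le> SP * xlnx (1 - l)" "real K * xlnx l \<le> SY * xlnx l"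
      using l xlnx_nonpos[of l] xlnx_nonpos[of "1 - l"] by (auto intro!: mult_right_mono_neg)
  qed
  moreover have "(real K + 1) * (- l) \<le> (real K + 1) * xlnx (1 - l)"
    using xlnx_tangent[of "1 - l" 1] l by (intro mult_left_mono) auto
  ultimately show ?thesis
    by (simp add: coupling_negentropy_def EP_def EY_def algebra_simps)
qed

lemma exp_1_plus_inverse_e_le: "exp (1 + exp (- 1)) \<le> (4 :: real)"
proof -
  have "8 / 3 \<le> exp (1 :: real)"
    using e_approx_32 by (simp add: abs_if split: if_splits)
  then have "exp (- 1) \<le> (3 / 8 :: real)"
    by (simp add: exp_minus inverse_eq_divide divide_le_eq)
  \<comment> \<open>\<open>11 / 8 = 1 + 3 / 8\<close>, and the margin suffices: \<open>2.72 ^ 11\<close> is about 60325, \<open>4 ^ 8\<close> is 65536.\<close>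
  moreover have "exp (11 / 8 :: real) \<le> 4"
  proof (rule power_le_imp_le_base)
    have "exp (11 / 8 :: real) ^ 8 = exp 1 ^ 11"
      by (simp add: exp_of_nat_mult[symmetric])
    also have "\<dots> \<le> (272 / 100) ^ 11"
      using e_less_272 by (intro power_mono) auto
    also have "\<dots> \<le> (4 :: real) ^ 8"
      by (simp add: power_divide)
    finally show "exp (11 / 8 :: real) ^ Suc 7 \<le> 4 ^ Suc 7"
      by simp
  qed simp
  moreover have "exp (1 + exp (- 1)) \<le> exp (11 / 8 :: real)" if "exp (- 1) \<le> (3 / 8 :: real)"
    using that by simp
  ultimately show ?thesis
    by linarith
qed

text \<open>
  The hypothesis is the optimality inequality after the mixture bound.  Dividing by \<open>l\<close> turns
  \<open>xlnx l\<close> into \<open>ln l\<close>; dividing by the total mass \<open>K + 1\<close> then gives the exponent.  The factor 4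
  absorbs \<open>exp (1 + 1 / e)\<close>, which comes from the \<open>K + 1\<close> units of mass and the \<open>K\<close> slack
  entropies \<open>1 / e\<close>.
\<close>

lemma mixture_weight_bound:
  assumes l: "0 \<le> l" and n: "0 < n"
    and le: "\<eta> * (l * \<Delta>) \<le> l * (2 * ln n + real K * exp (- 1)) + (real K + 1) * (l - xlnx l)"
  shows "l \<le> 4 * n powr (2 / (real K + 1)) * exp (- \<eta> * (\<Delta> / (real K + 1)))"
proof (cases "l = 0")
  case False
  then have l: "0 < l"
    using l by simp
  define R where "R = real K + 1"
  have R: "0 < R"
    by (simp add: R_def)
  have "l * (\<eta> * \<Delta>) \<le> l * (2 * ln n + real K * exp (- 1) + R * (1 - ln l))"
    using le by (simp add: xlnx_def R_def algebra_simps)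
  then have "\<eta> * \<Delta> \<le> 2 * ln n + real K * exp (- 1) + R * (1 - ln l)"
    using l by (rule mult_left_le_imp_le)
  moreover have "real K * exp (- 1) \<le> R * exp (- 1)"
    by (simp add: R_def)
  ultimately have "R * ln l \<le> 2 * ln n + R * (1 + exp (- 1)) - \<eta> * \<Delta>"
    unfolding right_diff_distrib distrib_left by linarith
  then have "ln l \<le> (2 * ln n + R * (1 + exp (- 1)) - \<eta> * \<Delta>) / R"
    using R by (simp add: pos_le_divide_eq mult.commute)
  also have "\<dots> = (1 + exp (- 1)) + 2 / R * ln n + - \<eta> * (\<Delta> / R)"
    using R by (simp add: field_simps)
  finally have "l \<le> exp ((1 + exp (- 1)) + 2 / R * ln n + - \<eta> * (\<Delta> / R))"
    using l by (metis exp_le_cancel_iff exp_ln)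
  also have "\<dots> = exp (1 + exp (- 1)) * n powr (2 / R) * exp (- \<eta> * (\<Delta> / R))"
    using n by (simp only: exp_add powr_def) simp
  also have "\<dots> \<le> 4 * n powr (2 / R) * exp (- \<eta> * (\<Delta> / R))"
    using exp_1_plus_inverse_e_le by (intro mult_right_mono) auto
  finally show ?thesis
    by (simp add: R_def)
qed simp

text \<open>
  The constant 8 is 2 times the 4 of \<open>mixture_weight_bound\<close>, because \<open>Q - Pstar\<close> is \<open>l\<close> times a
  difference of two matrices with nonnegative entries of sum 1, and such a difference has entrywise
  1-norm at most 2.
\<close>

lemma entropic_minimizer_distance:
  fixes C Pstar :: "real^'n^'n" and r c :: "real^'n" and D :: "nat \<Rightarrow> real^'n^'n" and K L :: nat
  defines "S \<equiv> constrained_couplings r c D K L"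
  assumes r: "(\<Sum>i\<in>UNIV. r $ i) = 1" and D: "\<forall>k\<in>{1..K}. infnorm (D k) \<le> 1"
    and unique: "argmins (\<lambda>P. C \<bullet> P) S = {Pstar}"
    and gap: "vertex_optimality_gap C S \<Delta>" and "0 < \<eta>"
    and Q: "Q \<in> argmins (\<lambda>P. C \<bullet> P + 1 / \<eta> * coupling_negentropy D K P) S"
  shows "entry_norm1 (Q - Pstar)
    \<le> 8 * real CARD('n) powr (2 / (real K + 1)) * exp (- \<eta> * (\<Delta> / (real K + 1)))"
proof -
  let ?E = "coupling_negentropy D K"
  have Pstar: "Pstar \<in> S"
    using unique argmins_iff[of Pstar "\<lambda>P. C \<bullet> P" S] by simp
  have QS: "Q \<in> S"
    using Q by (simp add: argmins_iff)
  obtain l Y where l: "0 \<le> l" "l \<le> 1" and Y: "Y \<in> S"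
    and Q_eq: "Q = (1 - l) *\<^sub>R Pstar + l *\<^sub>R Y" and cost: "l * \<Delta> \<le> C \<bullet> Q - C \<bullet> Pstar"
    using gap_decomposition[OF _ _ unique gap QS] compact_constrained_couplings[OF r]
      polyhedron_constrained_couplings unfolding S_def by metis
  have "C \<bullet> Q + 1 / \<eta> * ?E Q \<le> C \<bullet> Pstar + 1 / \<eta> * ?E Pstar"
    using Q Pstar by (simp add: argmins_iff)
  with cost have "l * \<Delta> \<le> (?E Pstar - ?E Q) / \<eta>"
    by (simp add: diff_divide_distrib)
  then have "\<eta> * (l * \<Delta>) \<le> ?E Pstar - ?E Q"
    using \<open>0 < \<eta>\<close> by (simp add: pos_le_divide_eq mult.commute)
  also have "\<dots> \<le> l * ?E Pstar - l * ?E Y + (real K + 1) * (l - xlnx l)"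
    using coupling_negentropy_mixture[OF Pstar[unfolded S_def] Y[unfolded S_def] r D l]
    by (simp add: Q_eq algebra_simps)
  also have "\<dots> \<le> l * (2 * ln (real CARD('n)) + real K * exp (- 1)) + (real K + 1) * (l - xlnx l)"
  proof -
    have "l * (?E Pstar - ?E Y) \<le> l * (2 * ln (real CARD('n)) + real K * exp (- 1))"
      using coupling_negentropy_nonpos[OF Pstar[unfolded S_def] r D]
        coupling_negentropy_ge[OF Y[unfolded S_def] r] l by (intro mult_left_mono) auto
    then show ?thesis
      by (simp add: right_diff_distrib)
  qed
  finally have l_le: "l \<le> 4 * real CARD('n) powr (2 / (real K + 1)) * exp (- \<eta> * (\<Delta> / (real K + 1)))"
    by (intro mixture_weight_bound l) simp_all
  have "Q - Pstar = l *\<^sub>R (Y - Pstar)"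
    by (simp add: Q_eq algebra_simps)
  then have "entry_norm1 (Q - Pstar) = l * entry_norm1 (Y - Pstar)"
    using l by (simp add: entry_norm1_scaleR)
  also have "\<dots> \<le> l * (1 + 1)"
    using entry_norm1_triangle[of Y Pstar] l constrained_couplings_entry_norm1[OF _ r] Pstar Y
    unfolding S_def by (intro mult_left_mono) (metis, simp)
  also have "\<dots> \<le> (4 * real CARD('n) powr (2 / (real K + 1)) * exp (- \<eta> * (\<Delta> / (real K + 1)))) * (1 + 1)"
    using l_le by (rule mult_right_mono) simp
  finally show ?thesis
    by simp
qed

theorem theorem1:
  fixes C Pstar :: "real^'n^'n"
    and D :: "nat \<Rightarrow> real^'n^'n"
    and r c :: "real^'n"
    and K L :: nat
  assumes r_nonneg: "\<forall>i. 0 \<le> r $ i"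
    and c_nonneg: "\<forall>j. 0 \<le> c $ j"
    and r_sum: "(\<Sum>i\<in>UNIV. r $ i) = 1"
    and c_sum: "(\<Sum>j\<in>UNIV. c $ j) = 1"
    and unique_solution: "argmins (\<lambda>P. C \<bullet> P) (constrained_couplings r c D K L) = {Pstar}"
    and D_bound: "\<forall>k\<in>{1..K}. infnorm (D k) \<le> 1"
  shows "(\<forall>\<eta>>0. \<exists>!x. x \<in> entropic_solutions C r c D K L \<eta>) \<and>
    (\<exists>\<Delta>>0. vertex_optimality_gap C (constrained_couplings r c D K L) \<Delta>) \<and>
    (\<forall>\<Delta>. vertex_optimality_gap C (constrained_couplings r c D K L) \<Delta> \<longrightarrow>
      0 < \<Delta> \<and>
      (\<forall>\<eta>. \<eta> \<ge> (real K + 1) * (1 + ln (4 * real CARD('n) ^ 2 * (real K + 1))) / \<Delta> \<longrightarrow>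
        entry_norm1 (entropic_plan C r c D K L \<eta> - Pstar)
          \<le> 8 * real CARD('n) powr (2 / (real K + 1)) * (real K + 1) * exp (- \<eta> * (\<Delta> / (real K + 1)))))"
proof -
  let ?S = "constrained_couplings r c D K L"
  have poly: "polyhedron ?S"
    by (rule polyhedron_constrained_couplings)
  have nonempty: "?S \<noteq> {}"
    using unique_solution argmins_iff[of Pstar "\<lambda>P. C \<bullet> P" ?S] by auto
  have solution: "\<exists>!x. x \<in> entropic_solutions C r c D K L \<eta>" if "0 < \<eta>" for \<eta>
    using entropic_solution_unique[OF r_sum nonempty that, of C] by (metis singleton_iff)
  have pos: "0 < \<Delta>" if "vertex_optimality_gap C ?S \<Delta>" for \<Delta>
    using vertex_optimality_gap_exists_pos(2)[OF poly unique_solution that] .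
  have rate: "entry_norm1 (entropic_plan C r c D K L \<eta> - Pstar)
      \<le> 8 * real CARD('n) powr (2 / (real K + 1)) * (real K + 1) * exp (- \<eta> * (\<Delta> / (real K + 1)))"
    if gap: "vertex_optimality_gap C ?S \<Delta>"
      and \<eta>: "\<eta> \<ge> (real K + 1) * (1 + ln (4 * real CARD('n) ^ 2 * (real K + 1))) / \<Delta>" for \<Delta> \<eta>
  proof -
    have "1 \<le> real CARD('n) ^ 2"
      by (intro one_le_power) (simp add: Suc_leI)
    then have "1 * 1 \<le> (4 * real CARD('n) ^ 2) * (real K + 1)"
      by (intro mult_mono) linarith+
    then have "0 < 1 + ln (4 * real CARD('n) ^ 2 * (real K + 1))"
      by (intro add_pos_nonneg ln_ge_zero) auto
    then have "0 < (real K + 1) * (1 + ln (4 * real CARD('n) ^ 2 * (real K + 1))) / \<Delta>"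
      using pos[OF gap] by (intro divide_pos_pos mult_pos_pos) auto
    then have "0 < \<eta>"
      using \<eta> by simp
    then obtain Q where Q: "entropic_solutions C r c D K L \<eta> = {with_slacks D K Q}"
      "argmins (\<lambda>P. C \<bullet> P + 1 / \<eta> * coupling_negentropy D K P) ?S = {Q}"
      using entropic_solution_unique[OF r_sum nonempty, of \<eta> C] by blast
    have "entropic_plan C r c D K L \<eta> = Q"
      by (simp add: entropic_plan_def Q(1) with_slacks_def)
    then have "entry_norm1 (entropic_plan C r c D K L \<eta> - Pstar)
        \<le> 8 * real CARD('n) powr (2 / (real K + 1)) * exp (- \<eta> * (\<Delta> / (real K + 1)))"
      using entropic_minimizer_distance[OF r_sum D_bound unique_solution gap \<open>0 < \<eta>\<close>] Q(2) by simp
    also have "\<dots> = 8 * real CARD('n) powr (2 / (real K + 1)) * 1 * exp (- \<eta> * (\<Delta> / (real K + 1)))"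
      by simp
    also have "\<dots> \<le> 8 * real CARD('n) powr (2 / (real K + 1)) * (real K + 1) * exp (- \<eta> * (\<Delta> / (real K + 1)))"
      by (intro mult_right_mono mult_left_mono) auto
    finally show ?thesis .
  qed
  show ?thesis
    using solution pos rate vertex_optimality_gap_exists_pos(1)[OF poly unique_solution] by blast
qed

end
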